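(* Assume the game is state dependent, i.e. $q(t,\mathbf{x},a;x)=q(t,\mathbf{x}_t,a;x)$, $g(\mathbf{x})=g(\mathbf{x}_T)$, $f_i(t,\mathbf{x},a_i)=f_i(t,\mathbf{x}_t,a_i)$. For deterministic times $t<T_0$ in $\mathbb{T}$ and $x\in\mathbb{S}_t$ let $$\tilde{\mathbb{V}}_{state}(t,x)=\Big\{J(T_0,\psi;t,x,\alpha^* ):\ \psi:\mathbb{S}_{T_0}\to\mathbb{R}^N,\ \psi(\tilde x)\in\mathbb{V}_{state}(T_0,\tilde x)\ \forall\tilde x\in\mathbb{S}_{T_0},\ \alpha^*\in\mathcal{A}_{state}\text{ an equilibrium in }\mathcal{A}_{state}\text{ at }(T_0,\psi;t,x)\Big\}.$$ Then $\mathbb{V}_{state}(t,x)\subset\tilde{\mathbb{V}}_{state}(t,x)$ always holds, but the inclusion can be strict: there exist a state dependent game of this type and $t<T_0$, $x\in\mathbb{S}_t$ for which $\mathbb{V}_{state}(t,x)\ne\tilde{\mathbb{V}}_{state}(t,x)$.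
   Context: Discrete-time game. $\mathbb{T}=\{0,1,\dots,T\}$; for each $t\in\mathbb{T}$, $\mathbb{S}_t$ is a (nonempty) finite set of states. $\mathbb{S}^{\mathbb{T}}=\{\mathbf{x}=(\mathbf{x}_0,\dots,\mathbf{x}_T):\mathbf{x}_t\in\mathbb{S}_t,\ t\in\mathbb{T}\}$ is the path space (the sample space), $X_t(\mathbf{x})=\mathbf{x}_t$ the canonical process. A function $\varphi$ of time and path is adapted if $\varphi(t,\mathbf{x})$ depends only on $(t,\mathbf{x}_0,\dots,\mathbf{x}_t)$. It is state dependent if $\varphi(t,\mathbf{x})=\varphi(t,\tilde{\mathbf{x}})$ whenever $\mathbf{x}_t=\tilde{\mathbf{x}}_t$, and is then written $\varphi(t,\mathbf{x}_t)$. Write $\mathbf{x}=_t\tilde{\mathbf{x}}$ if $\mathbf{x}_s=\tilde{\mathbf{x}}_s$ for $s=0,\dots,t$, and $\mathbb{S}^{\mathbb{T}}_{t,\mathbf{x}}=\{\tilde{\mathbf{x}}\in\mathbb{S}^{\mathbb{T}}:\tilde{\mathbf{x}}=_t\mathbf{x}\}$. There are $N$ players. Player $i$'s control values lie in a Borel measurable set $A_i$ in some topological space; $A=A_1\times\cdots\times A_N$. $\mathcal{A}_i$ is the set of adapted maps $\alpha_i:\mathbb{T}\times\mathbb{S}^{\mathbb{T}}\to A_i$, $\mathcal{A}=\mathcal{A}_1\times\cdots\times\mathcal{A}_N$. For each $(t,\mathbf{x},a)$ (with $t<T$), $q(t,\mathbf{x},a;\cdot):\mathbb{S}_{t+1}\to(0,1]$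 is a (strictly positive) transition probability: $\sum_{x\in\mathbb{S}_{t+1}}q(t,\mathbf{x},a;x)=1$. For $\alpha\in\mathcal{A}$, $\mathbb{P}^{t,\mathbf{x},\alpha}$ is the probability on $\mathbb{S}^{\mathbb{T}}$ with $\mathbb{P}^{t,\mathbf{x},\alpha}(X=_t\mathbf{x})=1$ and $\mathbb{P}^{t,\mathbf{x},\alpha}(X_{s+1}=x\mid X=_s\tilde{\mathbf{x}})=q(s,\tilde{\mathbf{x}},\alpha(s,\tilde{\mathbf{x}});x)$ for all $s\ge t$, $\tilde{\mathbf{x}}\in\mathbb{S}^{\mathbb{T}}_{t,\mathbf{x}}$, $x\in\mathbb{S}_{s+1}$. For $i=1,\dots,N$, $g_i:\mathbb{S}^{\mathbb{T}}\to\mathbb{R}$ and $f_i:\mathbb{T}\times\mathbb{S}^{\mathbb{T}}\times A_i\to\mathbb{R}$ is adapted and measurable in $a_i$. Costs: $J_i(t,\mathbf{x},\alpha)=\mathbb{E}^{\mathbb{P}^{t,\mathbf{x},\alpha}}\big[g_i(X)+\sum_{s=t}^{T-1}f_i(s,X,\alpha_i(s,X))\big]$, and for $\psi:\mathbb{S}_{T_0}\to\mathbb{R}^N$, $J_i(T_0,\psi;t,\mathbf{x},\alpha)=\mathbb{E}^{\mathbb{P}^{t,\mathbf{x},\alpha}}\big[\psi_i(X_{T_0})+\sum_{s=t}^{T_0-1}f_i(s,X,\alpha_i(s,X))\big]$; $J=(J_1,\dots,J_N)$. $(\alpha^{*,-i},\alpha_i)$ is $\alpha^*$ with $i$-th component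 replaced by $\alpha_i$. $\mathcal{A}_{state}=\mathcal{A}_{state,1}\times\cdots\times\mathcal{A}_{state,N}$ is the set of state dependent $\alpha\in\mathcal{A}$. In a state dependent game, for $\alpha\in\mathcal{A}_{state}$ and $\psi:\mathbb{S}_{T_0}\to\mathbb{R}^N$, both $J(t,\mathbf{x},\alpha)$ and $J(T_0,\psi;t,\mathbf{x},\alpha)$ depend on $\mathbf{x}$ only through $x=\mathbf{x}_t$ and are written $J(t,x,\alpha)$, $J(T_0,\psi;t,x,\alpha)$. $\alpha^*\in\mathcal{A}_{state}$ is an equilibrium in $\mathcal{A}_{state}$ at $(t,x)$ if $J_i(t,x,\alpha^* )\le J_i(t,x,\alpha^{*,-i},\alpha_i)$ for all $i$ and all $\alpha_i\in\mathcal{A}_{state,i}$ (deviations are only among state dependent controls), and an equilibrium in $\mathcal{A}_{state}$ at $(T_0,\psi;t,x)$ if the same holds with $J_i(T_0,\psi;t,x,\cdot)$. Define $\mathbb{V}_{state}(t,x)=\{J(t,x,\alpha^* ):\alpha^*\in\mathcal{A}_{state}\text{ is an equilibrium in }\mathcal{A}_{state}\text{ at }(t,x)\}$. *)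

theory Defs
  imports "HOL-Probability.Probability"
begin

section \<open>Games\<close>

text \<open>
  Players are numbered \<open>1, ..., n_players G\<close>; their control values may lie in different topological
  spaces, all realised as topologies on parts of the common type \<open>'a\<close>. Likewise the state sets of
  different times are subsets of one type \<open>'s\<close>.
\<close>

record ('s, 'a) game =
  horizon :: nat
  states :: "nat \<Rightarrow> 's set"
  n_players :: nat
  control_space :: "nat \<Rightarrow> 'a topology"
  controls :: "nat \<Rightarrow> 'a set"
  transition :: "nat \<Rightarrow> (nat \<Rightarrow> 's) \<Rightarrow> (nat \<Rightarrow> 'a) \<Rightarrow> 's \<Rightarrow> real"
  running_cost :: "nat \<Rightarrow> nat \<Rightarrow> (nat \<Rightarrow> 's) \<Rightarrow> 'a \<Rightarrow> real"
  terminal_cost :: "nat \<Rightarrow> (nat \<Rightarrow> 's) \<Rightarrow> real"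

definition paths :: "('s, 'a) game \<Rightarrow> (nat \<Rightarrow> 's) set" where
  "paths G = (\<Pi>\<^sub>E t\<in>{0..horizon G}. states G t)"

definition players :: "('s, 'a) game \<Rightarrow> nat set" where
  "players G = {1..n_players G}"

definition joint_controls :: "('s, 'a) game \<Rightarrow> (nat \<Rightarrow> 'a) set" where
  "joint_controls G = (\<Pi>\<^sub>E i\<in>players G. controls G i)"

definition agree_upto :: "nat \<Rightarrow> (nat \<Rightarrow> 's) \<Rightarrow> (nat \<Rightarrow> 's) \<Rightarrow> bool" where
  "agree_upto t x y \<longleftrightarrow> (\<forall>s\<le>t. x s = y s)"

definition paths_from :: "('s, 'a) game \<Rightarrow> nat \<Rightarrow> (nat \<Rightarrow> 's) \<Rightarrow> (nat \<Rightarrow> 's) set" where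
  "paths_from G t x = {y \<in> paths G. agree_upto t y x}"

definition adapted :: "('s, 'a) game \<Rightarrow> (nat \<Rightarrow> (nat \<Rightarrow> 's) \<Rightarrow> 'b) \<Rightarrow> bool" where
  "adapted G \<phi> \<longleftrightarrow>
     (\<forall>t\<le>horizon G. \<forall>x\<in>paths G. \<forall>y\<in>paths G. agree_upto t x y \<longrightarrow> \<phi> t x = \<phi> t y)"

definition state_dependent :: "('s, 'a) game \<Rightarrow> (nat \<Rightarrow> (nat \<Rightarrow> 's) \<Rightarrow> 'b) \<Rightarrow> bool" where
  "state_dependent G \<phi> \<longleftrightarrow>
     (\<forall>t\<le>horizon G. \<forall>x\<in>paths G. \<forall>y\<in>paths G. x t = y t \<longrightarrow> \<phi> t x = \<phi> t y)"

definition borel_of_topology :: "'a topology \<Rightarrow> 'a measure" where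
  "borel_of_topology \<tau> = sigma (topspace \<tau>) {U. openin \<tau> U}"

definition is_game :: "('s, 'a) game \<Rightarrow> bool" where
  "is_game G \<longleftrightarrow>
     (\<forall>t\<le>horizon G. finite (states G t) \<and> states G t \<noteq> {}) \<and>
     0 < n_players G \<and>
     (\<forall>i\<in>players G. controls G i \<in> sets (borel_of_topology (control_space G i))) \<and>
     (\<forall>t<horizon G. \<forall>x\<in>paths G. \<forall>a\<in>joint_controls G.
        (\<forall>z\<in>states G (Suc t). 0 < transition G t x a z \<and> transition G t x a z \<le> 1) \<and>
        (\<Sum>z\<in>states G (Suc t). transition G t x a z) = 1) \<and>
     (\<forall>t<horizon G. \<forall>x\<in>paths G. \<forall>y\<in>paths G. agree_upto t x y \<longrightarrow>
        (\<forall>a\<in>joint_controls G. \<forall>z\<in>states G (Suc t). transition G t x a z = transition G t y a z)) \<and>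
     (\<forall>i\<in>players G. \<forall>a\<in>controls G i. adapted G (\<lambda>t x. running_cost G i t x a)) \<and>
     (\<forall>i\<in>players G. \<forall>t\<le>horizon G. \<forall>x\<in>paths G.
        running_cost G i t x \<in>
          borel_measurable (restrict_space (borel_of_topology (control_space G i)) (controls G i)))"

definition state_dependent_game :: "('s, 'a) game \<Rightarrow> bool" where
  "state_dependent_game G \<longleftrightarrow> is_game G \<and>
     (\<forall>t<horizon G. \<forall>x\<in>paths G. \<forall>y\<in>paths G. x t = y t \<longrightarrow>
        (\<forall>a\<in>joint_controls G. \<forall>z\<in>states G (Suc t). transition G t x a z = transition G t y a z)) \<and>
     (\<forall>i\<in>players G. \<forall>x\<in>paths G. \<forall>y\<in>paths G. x (horizon G) = y (horizon G) \<longrightarrow>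
        terminal_cost G i x = terminal_cost G i y) \<and>
     (\<forall>i\<in>players G. \<forall>a\<in>controls G i. state_dependent G (\<lambda>t x. running_cost G i t x a))"


section \<open>Controls and path laws\<close>

definition adapted_controls :: "('s, 'a) game \<Rightarrow> nat \<Rightarrow> (nat \<Rightarrow> (nat \<Rightarrow> 's) \<Rightarrow> 'a) set" where
  "adapted_controls G i =
     {\<beta>. (\<forall>t\<le>horizon G. \<forall>x\<in>paths G. \<beta> t x \<in> controls G i) \<and> adapted G \<beta>}"

definition state_controls :: "('s, 'a) game \<Rightarrow> nat \<Rightarrow> (nat \<Rightarrow> (nat \<Rightarrow> 's) \<Rightarrow> 'a) set" where
  "state_controls G i = {\<beta> \<in> adapted_controls G i. state_dependent G \<beta>}"

type_synonym ('s, 'a) profile = "nat \<Rightarrow> nat \<Rightarrow> (nat \<Rightarrow> 's) \<Rightarrow> 'a"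

definition profiles :: "('s, 'a) game \<Rightarrow> ('s, 'a) profile set" where
  "profiles G = {\<alpha>. \<forall>i\<in>players G. \<alpha> i \<in> adapted_controls G i}"

definition state_profiles :: "('s, 'a) game \<Rightarrow> ('s, 'a) profile set" where
  "state_profiles G = {\<alpha>. \<forall>i\<in>players G. \<alpha> i \<in> state_controls G i}"

definition joint_action :: "('s, 'a) game \<Rightarrow> ('s, 'a) profile \<Rightarrow> nat \<Rightarrow> (nat \<Rightarrow> 's) \<Rightarrow> nat \<Rightarrow> 'a" where
  "joint_action G \<alpha> t x = (\<lambda>i\<in>players G. \<alpha> i t x)"

definition is_path_law ::
  "('s, 'a) game \<Rightarrow> nat \<Rightarrow> (nat \<Rightarrow> 's) \<Rightarrow> ('s, 'a) profile \<Rightarrow> (nat \<Rightarrow> 's) pmf \<Rightarrow> bool" where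
  "is_path_law G t x \<alpha> P \<longleftrightarrow>
     set_pmf P \<subseteq> paths G \<and>
     \<P>(X in measure_pmf P. agree_upto t X x) = 1 \<and>
     (\<forall>s\<in>{t..<horizon G}. \<forall>y\<in>paths_from G t x. \<forall>z\<in>states G (Suc s).
        \<P>(X in measure_pmf P. X (Suc s) = z \<bar> agree_upto s X y) =
          transition G s y (joint_action G \<alpha> s y) z)"

text \<open>Existence and uniqueness of this law are proved in \<open>ex1_path_law\<close> below.\<close>

definition path_law ::
  "('s, 'a) game \<Rightarrow> nat \<Rightarrow> (nat \<Rightarrow> 's) \<Rightarrow> ('s, 'a) profile \<Rightarrow> (nat \<Rightarrow> 's) pmf" where
  "path_law G t x \<alpha> = (THE P. is_path_law G t x \<alpha> P)"


section \<open>Costs, equilibria and set values\<close>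

text \<open>A vector in \<open>\<real>\<^sup>N\<close> is a function on \<open>players G\<close>, made extensional so that equality of
  vectors is equality of functions.\<close>

definition cost :: "('s, 'a) game \<Rightarrow> nat \<Rightarrow> (nat \<Rightarrow> 's) \<Rightarrow> ('s, 'a) profile \<Rightarrow> nat \<Rightarrow> real" where
  "cost G t x \<alpha> = (\<lambda>i\<in>players G. measure_pmf.expectation (path_law G t x \<alpha>)
     (\<lambda>X. terminal_cost G i X + (\<Sum>s\<in>{t..<horizon G}. running_cost G i s X (\<alpha> i s X))))"

definition cost_upto :: "('s, 'a) game \<Rightarrow> nat \<Rightarrow> ('s \<Rightarrow> nat \<Rightarrow> real) \<Rightarrow>
    nat \<Rightarrow> (nat \<Rightarrow> 's) \<Rightarrow> ('s, 'a) profile \<Rightarrow> nat \<Rightarrow> real" where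
  "cost_upto G T0 \<psi> t x \<alpha> = (\<lambda>i\<in>players G. measure_pmf.expectation (path_law G t x \<alpha>)
     (\<lambda>X. \<psi> (X T0) i + (\<Sum>s\<in>{t..<T0}. running_cost G i s X (\<alpha> i s X))))"

text \<open>In a state dependent game and for state dependent \<open>\<alpha>\<close> the costs depend on the path only
  through its value at time \<open>t\<close> (\<open>cost_state_eq\<close> and \<open>cost_upto_state_eq\<close> below), so they may be
  evaluated along an arbitrary path through the given state.\<close>

definition path_through :: "('s, 'a) game \<Rightarrow> nat \<Rightarrow> 's \<Rightarrow> nat \<Rightarrow> 's" where
  "path_through G t x = (SOME y. y \<in> paths G \<and> y t = x)"

definition state_cost :: "('s, 'a) game \<Rightarrow> nat \<Rightarrow> 's \<Rightarrow> ('s, 'a) profile \<Rightarrow> nat \<Rightarrow> real" where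
  "state_cost G t x \<alpha> = cost G t (path_through G t x) \<alpha>"

definition state_cost_upto :: "('s, 'a) game \<Rightarrow> nat \<Rightarrow> ('s \<Rightarrow> nat \<Rightarrow> real) \<Rightarrow>
    nat \<Rightarrow> 's \<Rightarrow> ('s, 'a) profile \<Rightarrow> nat \<Rightarrow> real" where
  "state_cost_upto G T0 \<psi> t x \<alpha> = cost_upto G T0 \<psi> t (path_through G t x) \<alpha>"

definition state_equilibrium :: "('s, 'a) game \<Rightarrow> nat \<Rightarrow> 's \<Rightarrow> ('s, 'a) profile \<Rightarrow> bool" where
  "state_equilibrium G t x \<alpha> \<longleftrightarrow> \<alpha> \<in> state_profiles G \<and>
     (\<forall>i\<in>players G. \<forall>\<beta>\<in>state_controls G i.
        state_cost G t x \<alpha> i \<le> state_cost G t x (\<alpha>(i := \<beta>)) i)"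

definition state_equilibrium_upto :: "('s, 'a) game \<Rightarrow> nat \<Rightarrow> ('s \<Rightarrow> nat \<Rightarrow> real) \<Rightarrow>
    nat \<Rightarrow> 's \<Rightarrow> ('s, 'a) profile \<Rightarrow> bool" where
  "state_equilibrium_upto G T0 \<psi> t x \<alpha> \<longleftrightarrow> \<alpha> \<in> state_profiles G \<and>
     (\<forall>i\<in>players G. \<forall>\<beta>\<in>state_controls G i.
        state_cost_upto G T0 \<psi> t x \<alpha> i \<le> state_cost_upto G T0 \<psi> t x (\<alpha>(i := \<beta>)) i)"

definition V_state :: "('s, 'a) game \<Rightarrow> nat \<Rightarrow> 's \<Rightarrow> (nat \<Rightarrow> real) set" where
  "V_state G t x = {state_cost G t x \<alpha> | \<alpha>. state_equilibrium G t x \<alpha>}"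

definition V_state_tilde :: "('s, 'a) game \<Rightarrow> nat \<Rightarrow> nat \<Rightarrow> 's \<Rightarrow> (nat \<Rightarrow> real) set" where
  "V_state_tilde G T0 t x = {state_cost_upto G T0 \<psi> t x \<alpha> | \<psi> \<alpha>.
     (\<forall>y\<in>states G T0. \<psi> y \<in> V_state G T0 y) \<and> state_equilibrium_upto G T0 \<psi> t x \<alpha>}"


section \<open>Well-definedness of the path law\<close>

lemma finite_paths: "is_game G \<Longrightarrow> finite (paths G)"
  by (auto simp: paths_def is_game_def intro!: finite_PiE)

lemma paths_memD: "x \<in> paths G \<Longrightarrow> t \<le> horizon G \<Longrightarrow> x t \<in> states G t"
  by (auto simp: paths_def)

lemma paths_upd: "y \<in> paths G \<Longrightarrow> t \<le> horizon G \<Longrightarrow> z \<in> states G t \<Longrightarrow> y(t := z) \<in> paths G"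
  by (auto simp: paths_def PiE_iff extensional_def)

lemma agree_upto_horizon:
  "x \<in> paths G \<Longrightarrow> y \<in> paths G \<Longrightarrow> agree_upto (horizon G) x y \<Longrightarrow> x = y"
  unfolding paths_def agree_upto_def by (intro ext) (metis PiE_arb atLeastAtMost_iff)

lemma joint_action_in:
  assumes "\<alpha> \<in> profiles G" "t \<le> horizon G" "x \<in> paths G"
  shows "joint_action G \<alpha> t x \<in> joint_controls G"
  using assms by (auto simp: joint_action_def joint_controls_def profiles_def adapted_controls_def)

lemma joint_action_agree:
  assumes "\<alpha> \<in> profiles G" "t \<le> horizon G" "x \<in> paths G" "y \<in> paths G" "agree_upto t x y"
  shows "joint_action G \<alpha> t x = joint_action G \<alpha> t y"
  using assms
  by (auto simp: joint_action_def profiles_def adapted_controls_def adapted_def restrict_def fun_eq_iff)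

definition step_prob :: "('s, 'a) game \<Rightarrow> ('s, 'a) profile \<Rightarrow> nat \<Rightarrow> (nat \<Rightarrow> 's) \<Rightarrow> real" where
  "step_prob G \<alpha> s y = transition G s y (joint_action G \<alpha> s y) (y (Suc s))"

lemma step_prob_pos:
  assumes "is_game G" "\<alpha> \<in> profiles G" "s < horizon G" "y \<in> paths G"
  shows "0 < step_prob G \<alpha> s y"
  using assms joint_action_in[of \<alpha> G s y] paths_memD[of y G "Suc s"]
  by (auto simp: step_prob_def is_game_def)

lemma step_prob_agree:
  assumes "is_game G" "\<alpha> \<in> profiles G" "s < horizon G" "y \<in> paths G" "y' \<in> paths G"
    "agree_upto (Suc s) y y'"
  shows "step_prob G \<alpha> s y = step_prob G \<alpha> s y'"
proof -
  have ag: "agree_upto s y y'" and e: "y (Suc s) = y' (Suc s)"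
    using assms(6) by (auto simp: agree_upto_def)
  have "joint_action G \<alpha> s y = joint_action G \<alpha> s y'"
    using joint_action_agree assms ag by (metis less_imp_le)
  moreover have "joint_action G \<alpha> s y' \<in> joint_controls G"
    using joint_action_in assms by (metis less_imp_le)
  moreover have "y' (Suc s) \<in> states G (Suc s)" using paths_memD assms by fastforce
  ultimately show ?thesis
    unfolding step_prob_def e using assms(1,3-5) ag by (simp add: is_game_def)
qed

lemma prod_step_prob_agree:
  assumes "is_game G" "\<alpha> \<in> profiles G" "s \<le> horizon G" "y \<in> paths G" "y' \<in> paths G"
    "agree_upto s y y'"
  shows "(\<Prod>r\<in>{t..<s}. step_prob G \<alpha> r y) = (\<Prod>r\<in>{t..<s}. step_prob G \<alpha> r y')"
proof (rule prod.cong[OF refl])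
  fix r assume "r \<in> {t..<s}"
  then show "step_prob G \<alpha> r y = step_prob G \<alpha> r y'"
    using assms by (intro step_prob_agree) (auto simp: agree_upto_def)
qed

lemma sum_step_prob:
  assumes "is_game G" "\<alpha> \<in> profiles G" "s < horizon G" "y \<in> paths G"
  shows "(\<Sum>z\<in>states G (Suc s). transition G s y (joint_action G \<alpha> s y) z) = 1"
  using assms joint_action_in[of \<alpha> G s y] by (auto simp: is_game_def)

lemma paths_from_split:
  assumes "s < horizon G" "y \<in> paths G"
  shows "paths_from G s y = (\<Union>z\<in>states G (Suc s). paths_from G (Suc s) (y(Suc s := z)))"
  using assms unfolding paths_from_def agree_upto_def
  by (auto simp: le_Suc_eq intro!: paths_memD)

lemma sum_paths_from:
  assumes g: "is_game G" and a: "\<alpha> \<in> profiles G" and "t \<le> s" "s \<le> horizon G" "y \<in> paths G"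
  shows "(\<Sum>w\<in>paths_from G s y. \<Prod>r\<in>{t..<horizon G}. step_prob G \<alpha> r w) =
         (\<Prod>r\<in>{t..<s}. step_prob G \<alpha> r y)"
  using assms(4,3,5)
proof (induction s arbitrary: y rule: inc_induct)
  case base
  have "paths_from G (horizon G) y = {y}"
    using base agree_upto_horizon by (auto simp: paths_from_def agree_upto_def)
  then show ?case by simp
next
  case (step s)
  let ?u = "\<lambda>z. y(Suc s := z)"
  have u: "?u z \<in> paths G" if "z \<in> states G (Suc s)" for z
    using paths_upd step that by fastforce
  have fin: "finite (states G (Suc s))" using g step by (auto simp: is_game_def)
  have finp: "finite (paths_from G (Suc s) w)" for w
    using finite_paths[OF g] by (auto simp: paths_from_def)
  have "(\<Sum>w\<in>paths_from G s y. \<Prod>r\<in>{t..<horizon G}. step_prob G \<alpha> r w) =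
        (\<Sum>z\<in>states G (Suc s). \<Sum>w\<in>paths_from G (Suc s) (?u z).
           \<Prod>r\<in>{t..<horizon G}. step_prob G \<alpha> r w)"
    unfolding paths_from_split[OF step.hyps(2) step.prems(2)]
    by (intro sum.UNION_disjoint fin ballI finp impI)
       (auto simp: paths_from_def agree_upto_def)
  also have "\<dots> = (\<Sum>z\<in>states G (Suc s). \<Prod>r\<in>{t..<Suc s}. step_prob G \<alpha> r (?u z))"
    using step.prems u by (intro sum.cong refl step.IH) (auto simp del: fun_upd_apply)
  also have "\<dots> = (\<Sum>z\<in>states G (Suc s). (\<Prod>r\<in>{t..<s}. step_prob G \<alpha> r y) *
                     transition G s y (joint_action G \<alpha> s y) z)"
  proof (rule sum.cong[OF refl])
    fix z assume z: "z \<in> states G (Suc s)"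
    have ag: "agree_upto s (?u z) y" by (auto simp: agree_upto_def)
    have 1: "(\<Prod>r\<in>{t..<s}. step_prob G \<alpha> r (?u z)) = (\<Prod>r\<in>{t..<s}. step_prob G \<alpha> r y)"
      using prod_step_prob_agree[OF g a _ u[OF z] step.prems(2) ag] step by simp
    have ja: "joint_action G \<alpha> s (?u z) = joint_action G \<alpha> s y"
      using joint_action_agree[OF a _ u[OF z] step.prems(2) ag] step by simp
    have "joint_action G \<alpha> s y \<in> joint_controls G"
      using joint_action_in[OF a _ step.prems(2)] step by simp
    then have 2: "step_prob G \<alpha> s (?u z) = transition G s y (joint_action G \<alpha> s y) z"
      unfolding step_prob_def ja using g step u[OF z] z ag by (simp add: is_game_def)
    show "(\<Prod>r\<in>{t..<Suc s}. step_prob G \<alpha> r (?u z)) =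
        (\<Prod>r\<in>{t..<s}. step_prob G \<alpha> r y) * transition G s y (joint_action G \<alpha> s y) z"
      using step 1 2 by simp
  qed
  also have "\<dots> = (\<Prod>r\<in>{t..<s}. step_prob G \<alpha> r y)"
    using sum_step_prob[OF g a _ step.prems(2)] step by (simp flip: sum_distrib_left)
  finally show ?case .
qed

definition path_density ::
  "('s, 'a) game \<Rightarrow> nat \<Rightarrow> (nat \<Rightarrow> 's) \<Rightarrow> ('s, 'a) profile \<Rightarrow> (nat \<Rightarrow> 's) \<Rightarrow> real" where
  "path_density G t x \<alpha> y =
     (if y \<in> paths_from G t x then \<Prod>r\<in>{t..<horizon G}. step_prob G \<alpha> r y else 0)"

lemma path_density_exists:
  assumes g: "is_game G" and a: "\<alpha> \<in> profiles G" and "t \<le> horizon G" "x \<in> paths G"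
  shows "\<exists>P. pmf P = path_density G t x \<alpha>"
proof -
  have nn: "0 \<le> path_density G t x \<alpha> y" for y
    unfolding path_density_def using step_prob_pos[OF g a]
    by (auto intro!: prod_nonneg simp: paths_from_def less_imp_le)
  have fin: "finite (paths_from G t x)" using finite_paths[OF g] by (auto simp: paths_from_def)
  have "(\<integral>\<^sup>+y. ennreal (path_density G t x \<alpha> y) \<partial>count_space UNIV) =
        (\<Sum>y\<in>paths_from G t x. ennreal (path_density G t x \<alpha> y))"
    using fin by (intro nn_integral_count_space') (auto simp: path_density_def)
  also have "\<dots> = ennreal (\<Sum>y\<in>paths_from G t x. path_density G t x \<alpha> y)"
    using nn by (intro sum_ennreal) auto
  also have "(\<Sum>y\<in>paths_from G t x. path_density G t x \<alpha> y) = 1"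
    using sum_paths_from[OF g a order_refl assms(3,4)] by (simp add: path_density_def)
  finally have "pmf (embed_pmf (path_density G t x \<alpha>)) y = path_density G t x \<alpha> y" for y
    using nn by (intro pmf_embed_pmf) auto
  then show ?thesis by blast
qed

lemma is_path_law_iff:
  assumes g: "is_game G" and a: "\<alpha> \<in> profiles G" and t: "t \<le> horizon G" and x: "x \<in> paths G"
  shows "is_path_law G t x \<alpha> P \<longleftrightarrow> pmf P = path_density G t x \<alpha>"
proof
  assume P: "pmf P = path_density G t x \<alpha>"
  have finp: "finite (paths_from G s y)" for s y
    using finite_paths[OF g] by (auto simp: paths_from_def)
  have supp: "set_pmf P \<subseteq> paths_from G t x"
    by (auto simp: set_pmf_eq P path_density_def split: if_splits)
  have pr: "measure_pmf.prob P {X. agree_upto s X y} = (\<Prod>r\<in>{t..<s}. step_prob G \<alpha> r y)"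
    if "t \<le> s" "s \<le> horizon G" "y \<in> paths_from G t x" for s y
  proof -
    have sub: "paths_from G s y \<subseteq> paths_from G t x"
      using that by (auto simp: paths_from_def agree_upto_def)
    have "measure_pmf.prob P {X. agree_upto s X y} = measure_pmf.prob P (paths_from G s y)"
      using supp by (intro measure_prob_cong_0) (auto simp: paths_from_def set_pmf_eq)
    also have "\<dots> = (\<Sum>w\<in>paths_from G s y. pmf P w)"
      by (simp add: measure_measure_pmf_finite finp)
    also have "\<dots> = (\<Sum>w\<in>paths_from G s y. \<Prod>r\<in>{t..<horizon G}. step_prob G \<alpha> r w)"
      using sub by (intro sum.cong) (auto simp: P path_density_def)
    also have "\<dots> = (\<Prod>r\<in>{t..<s}. step_prob G \<alpha> r y)"
      using that by (intro sum_paths_from[OF g a]) (auto simp: paths_from_def)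
    finally show ?thesis .
  qed
  show "is_path_law G t x \<alpha> P"
    unfolding is_path_law_def
  proof (intro conjI ballI)
    show "set_pmf P \<subseteq> paths G" using supp by (auto simp: paths_from_def)
    show "\<P>(X in measure_pmf P. agree_upto t X x) = 1"
      using pr[of t x] t x by (simp add: paths_from_def agree_upto_def)
    fix s y z assume s: "s \<in> {t..<horizon G}" and y: "y \<in> paths_from G t x"
      and z: "z \<in> states G (Suc s)"
    let ?u = "y(Suc s := z)"
    have yp: "y \<in> paths G" using y by (simp add: paths_from_def)
    have up: "?u \<in> paths G" using paths_upd[OF yp _ z] s by simp
    have ut: "?u \<in> paths_from G t x" using up y s by (auto simp: paths_from_def agree_upto_def)
    have ag: "agree_upto s ?u y" by (auto simp: agree_upto_def)
    have ev: "{X. X (Suc s) = z \<and> agree_upto s X y} = {X. agree_upto (Suc s) X ?u}"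
      by (auto simp: agree_upto_def le_Suc_eq)
    have pos: "0 < (\<Prod>r\<in>{t..<s}. step_prob G \<alpha> r y)"
      using s step_prob_pos[OF g a _ yp] by (intro prod_pos) auto
    have ja: "joint_action G \<alpha> s ?u = joint_action G \<alpha> s y"
      using joint_action_agree[OF a _ up yp ag] s by simp
    have "joint_action G \<alpha> s y \<in> joint_controls G"
      using joint_action_in[OF a _ yp] s by simp
    then have sp: "step_prob G \<alpha> s ?u = transition G s y (joint_action G \<alpha> s y) z"
      unfolding step_prob_def ja using g s up yp z ag by (simp add: is_game_def)
    have "(\<Prod>r\<in>{t..<Suc s}. step_prob G \<alpha> r ?u) =
        (\<Prod>r\<in>{t..<s}. step_prob G \<alpha> r y) * transition G s y (joint_action G \<alpha> s y) z"
      using s prod_step_prob_agree[OF g a _ up yp ag] sp by simp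
    then show "\<P>(X in measure_pmf P. X (Suc s) = z \<bar> agree_upto s X y) =
          transition G s y (joint_action G \<alpha> s y) z"
      using pr[of s y] pr[of "Suc s" ?u] s y ut less_imp_neq[OF pos]
      by (simp add: cond_prob_def ev del: prod_zero_iff)
  qed
next
  assume L: "is_path_law G t x \<alpha> P"
  have pr: "measure_pmf.prob P {X. agree_upto s X y} = (\<Prod>r\<in>{t..<s}. step_prob G \<alpha> r y)"
    if "t \<le> s" "s \<le> horizon G" "y \<in> paths_from G t x" for s y
    using that
  proof (induction s rule: dec_induct)
    case base
    have "{X. agree_upto t X y} = {X. agree_upto t X x}"
      using base by (auto simp: paths_from_def agree_upto_def)
    then show ?case using L by (simp add: is_path_law_def)
  next
    case (step s)
    have ev: "{X. X (Suc s) = y (Suc s) \<and> agree_upto s X y} = {X. agree_upto (Suc s) X y}"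
      by (auto simp: agree_upto_def le_Suc_eq)
    have yp: "y \<in> paths G" using step by (simp add: paths_from_def)
    have IH: "measure_pmf.prob P {X. agree_upto s X y} = (\<Prod>r\<in>{t..<s}. step_prob G \<alpha> r y)"
      using step by simp
    have pos: "0 < (\<Prod>r\<in>{t..<s}. step_prob G \<alpha> r y)"
      using step step_prob_pos[OF g a _ yp] by (intro prod_pos) auto
    have "\<P>(X in measure_pmf P. X (Suc s) = y (Suc s) \<bar> agree_upto s X y) = step_prob G \<alpha> s y"
      using L step paths_memD[OF yp, of "Suc s"] by (auto simp: is_path_law_def step_prob_def)
    then have "measure_pmf.prob P {X. agree_upto (Suc s) X y} =
        step_prob G \<alpha> s y * (\<Prod>r\<in>{t..<s}. step_prob G \<alpha> r y)"
      using less_imp_neq[OF pos] IH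
      by (simp add: cond_prob_def ev nonzero_divide_eq_eq del: prod_zero_iff)
    then show ?case using step by (simp add: mult.commute)
  qed
  show "pmf P = path_density G t x \<alpha>"
  proof
    fix y
    have "measure_pmf.prob P {X. agree_upto t X x} = 1" using L by (simp add: is_path_law_def)
    then have "AE X in measure_pmf P. X \<in> {X. agree_upto t X x}"
      by (subst (asm) measure_pmf.prob_eq_1) auto
    then have supp: "set_pmf P \<subseteq> paths_from G t x"
      using L by (auto simp: is_path_law_def paths_from_def AE_measure_pmf_iff)
    show "pmf P y = path_density G t x \<alpha> y"
    proof (cases "y \<in> paths_from G t x")
      case True
      have "measure_pmf.prob P {X. agree_upto (horizon G) X y} = measure_pmf.prob P {y}"
      proof (rule measure_prob_cong_0)
        fix w assume "w \<in> {X. agree_upto (horizon G) X y} - {y}"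
        then have "w \<notin> paths G" using agree_upto_horizon True by (auto simp: paths_from_def)
        then show "pmf P w = 0" using supp by (auto simp: paths_from_def set_pmf_eq)
      next
        fix w assume "w \<in> {y} - {X. agree_upto (horizon G) X y}"
        then show "pmf P w = 0" by (auto simp: agree_upto_def)
      qed
      then show ?thesis using pr[OF t order_refl True] True
        by (simp add: measure_pmf_single path_density_def)
    next
      case False
      then show ?thesis using supp by (auto simp: path_density_def set_pmf_eq)
    qed
  qed
qed

lemma ex1_path_law:
  assumes "is_game G" "\<alpha> \<in> profiles G" "t \<le> horizon G" "x \<in> paths G"
  shows "\<exists>!P. is_path_law G t x \<alpha> P"
  using path_density_exists[OF assms] unfolding is_path_law_iff[OF assms]
  by (metis pmf_eqI)

lemma pmf_path_law:
  assumes "is_game G" "\<alpha> \<in> profiles G" "t \<le> horizon G" "x \<in> paths G"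
  shows "pmf (path_law G t x \<alpha>) = path_density G t x \<alpha>"
  using theI'[OF ex1_path_law[OF assms]] unfolding path_law_def is_path_law_iff[OF assms] .


section \<open>In state dependent games the costs depend only on the current state\<close>

lemma state_profiles_subset: "state_profiles G \<subseteq> profiles G"
  by (auto simp: state_profiles_def profiles_def state_controls_def)

lemma expectation_path_law:
  assumes g: "is_game G" and "\<alpha> \<in> profiles G" "t \<le> horizon G" "x \<in> paths G"
  shows "measure_pmf.expectation (path_law G t x \<alpha>) c =
         (\<Sum>y\<in>paths_from G t x. (\<Prod>r\<in>{t..<horizon G}. step_prob G \<alpha> r y) * c y)"
proof -
  have "finite (paths_from G t x)" using finite_paths[OF g] by (auto simp: paths_from_def)
  moreover have "set_pmf (path_law G t x \<alpha>) \<subseteq> paths_from G t x"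
    by (auto simp: set_pmf_eq pmf_path_law[OF assms] path_density_def split: if_splits)
  ultimately have "measure_pmf.expectation (path_law G t x \<alpha>) c =
      (\<Sum>y\<in>paths_from G t x. pmf (path_law G t x \<alpha>) y *\<^sub>R c y)"
    by (intro integral_measure_pmf) auto
  also have "\<dots> = (\<Sum>y\<in>paths_from G t x. (\<Prod>r\<in>{t..<horizon G}. step_prob G \<alpha> r y) * c y)"
    by (intro sum.cong) (auto simp: pmf_path_law[OF assms] path_density_def)
  finally show ?thesis .
qed

lemma expectation_state_eq:
  fixes c :: "(nat \<Rightarrow> 's) \<Rightarrow> real"
  assumes g: "state_dependent_game (G :: ('s, 'a) game)" and a: "\<alpha> \<in> state_profiles G" and t: "t \<le> horizon G"
    and x: "x \<in> paths G" and x': "x' \<in> paths G" and eq: "x t = x' t"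
    and c: "\<And>y y'. y \<in> paths G \<Longrightarrow> y' \<in> paths G \<Longrightarrow> (\<And>s. t \<le> s \<Longrightarrow> y s = y' s) \<Longrightarrow> c y = c y'"
  shows "measure_pmf.expectation (path_law G t x \<alpha>) c = measure_pmf.expectation (path_law G t x' \<alpha>) c"
proof -
  have g': "is_game G" using g by (simp add: state_dependent_game_def)
  have a': "\<alpha> \<in> profiles G" using a state_profiles_subset by blast
  let ?h = "\<lambda>w y s. if s < t then w s else y s"
  have hp: "?h w y \<in> paths G" if "w \<in> paths G" "y \<in> paths G" for w y
    using that t by (auto simp: paths_def PiE_iff extensional_def)
  have sp: "step_prob G \<alpha> r y = step_prob G \<alpha> r y'"
    if y: "y \<in> paths G" and y': "y' \<in> paths G" and e: "\<And>s. t \<le> s \<Longrightarrow> y s = y' s"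
      and r: "r \<in> {t..<horizon G}" for r y y'
  proof -
    have er: "y r = y' r" "y (Suc r) = y' (Suc r)" using e r by auto
    have ja: "joint_action G \<alpha> r y = joint_action G \<alpha> r y'"
      unfolding joint_action_def
    proof (rule restrict_ext)
      fix i assume "i \<in> players G"
      then have "state_dependent G (\<alpha> i)"
        using a by (simp add: state_profiles_def state_controls_def)
      moreover have "r \<le> horizon G" using r by simp
      ultimately show "\<alpha> i r y = \<alpha> i r y'"
        using y y' er(1) unfolding state_dependent_def by blast
    qed
    have "joint_action G \<alpha> r y' \<in> joint_controls G" using joint_action_in[OF a' _ y'] r by simp
    moreover have "y' (Suc r) \<in> states G (Suc r)" using paths_memD[OF y'] r by simp
    moreover have "r < horizon G" using r by simp
    ultimately show ?thesis
      unfolding step_prob_def ja er(2) using g y y' er(1)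
      unfolding state_dependent_game_def by blast
  qed
  show ?thesis
    unfolding expectation_path_law[OF g' a' t x] expectation_path_law[OF g' a' t x']
  proof (rule sum.reindex_bij_witness[where i = "?h x" and j = "?h x'"])
    fix y assume y: "y \<in> paths_from G t x"
    then have yp: "y \<in> paths G" by (simp add: paths_from_def)
    show "?h x (?h x' y) = y" using y by (auto simp: paths_from_def agree_upto_def)
    show "?h x' y \<in> paths_from G t x'"
      using y hp[OF x' yp] eq by (auto simp: paths_from_def agree_upto_def)
    have "(\<Prod>r\<in>{t..<horizon G}. step_prob G \<alpha> r (?h x' y)) =
          (\<Prod>r\<in>{t..<horizon G}. step_prob G \<alpha> r y)"
      using hp[OF x' yp] yp by (intro prod.cong refl sp) auto
    moreover have "c (?h x' y) = c y" using hp[OF x' yp] yp by (intro c) auto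
    ultimately show "(\<Prod>r\<in>{t..<horizon G}. step_prob G \<alpha> r (?h x' y)) * c (?h x' y) =
          (\<Prod>r\<in>{t..<horizon G}. step_prob G \<alpha> r y) * c y" by simp
  next
    fix y assume y: "y \<in> paths_from G t x'"
    then have yp: "y \<in> paths G" by (simp add: paths_from_def)
    show "?h x' (?h x y) = y" using y by (auto simp: paths_from_def agree_upto_def)
    show "?h x y \<in> paths_from G t x"
      using y hp[OF x yp] eq by (auto simp: paths_from_def agree_upto_def)
  qed
qed

lemma running_cost_state_eq:
  assumes "state_dependent_game G" "\<alpha> \<in> state_profiles G" "i \<in> players G" "s \<le> horizon G"
    "y \<in> paths G" "y' \<in> paths G" "y s = y' s"
  shows "running_cost G i s y (\<alpha> i s y) = running_cost G i s y' (\<alpha> i s y')"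
proof -
  have "\<alpha> i \<in> state_controls G i" using assms(2,3) by (simp add: state_profiles_def)
  then have 1: "\<alpha> i s y = \<alpha> i s y'" and 2: "\<alpha> i s y' \<in> controls G i"
    using assms(4-7) unfolding state_controls_def adapted_controls_def state_dependent_def by blast+
  have "state_dependent G (\<lambda>t x. running_cost G i t x (\<alpha> i s y'))"
    using assms(1,3) 2 unfolding state_dependent_game_def by blast
  then show ?thesis
    using assms(4-7) unfolding 1 state_dependent_def by blast
qed

lemma cost_state_eq:
  assumes "state_dependent_game G" "\<alpha> \<in> state_profiles G" "t \<le> horizon G"
    "x \<in> paths G" "x' \<in> paths G" "x t = x' t"
  shows "cost G t x \<alpha> = cost G t x' \<alpha>"
  unfolding cost_def
proof (rule restrict_ext, rule expectation_state_eq[OF assms], intro arg_cong2[where f = "(+)"] sum.cong refl)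
  fix i y y' assume i: "i \<in> players G" and y: "y \<in> paths G" "y' \<in> paths G"
    and e: "\<And>s. t \<le> s \<Longrightarrow> y s = y' s"
  show "terminal_cost G i y = terminal_cost G i y'"
    using assms(1) i y e[OF assms(3)] unfolding state_dependent_game_def by blast
  fix s assume "s \<in> {t..<horizon G}"
  then show "running_cost G i s y (\<alpha> i s y) = running_cost G i s y' (\<alpha> i s y')"
    using e by (intro running_cost_state_eq[OF assms(1,2) i _ y]) auto
qed

lemma cost_upto_state_eq:
  assumes "state_dependent_game G" "\<alpha> \<in> state_profiles G" "t \<le> horizon G"
    "x \<in> paths G" "x' \<in> paths G" "x t = x' t" "t \<le> T0" "T0 \<le> horizon G"
  shows "cost_upto G T0 \<psi> t x \<alpha> = cost_upto G T0 \<psi> t x' \<alpha>"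
  unfolding cost_upto_def
proof (rule restrict_ext, rule expectation_state_eq[OF assms(1-6)], intro arg_cong2[where f = "(+)"] sum.cong refl)
  fix i y y' assume i: "i \<in> players G" and y: "y \<in> paths G" "y' \<in> paths G"
    and e: "\<And>s. t \<le> s \<Longrightarrow> y s = y' s"
  show "\<psi> (y T0) i = \<psi> (y' T0) i" using e assms(7) by simp
  fix s assume "s \<in> {t..<T0}"
  then show "running_cost G i s y (\<alpha> i s y) = running_cost G i s y' (\<alpha> i s y')"
    using e assms(8) by (intro running_cost_state_eq[OF assms(1,2) i _ y]) auto
qed

lemma path_through:
  assumes "is_game G" "t \<le> horizon G" "x \<in> states G t"
  shows "path_through G t x \<in> paths G \<and> path_through G t x t = x"
proof -
  have "paths G \<noteq> {}"
    using assms(1) by (simp add: paths_def is_game_def PiE_eq_empty_iff)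
  then obtain y where "y \<in> paths G" by blast
  then have "y(t := x) \<in> paths G \<and> (y(t := x)) t = x" using paths_upd assms by simp
  then show ?thesis unfolding path_through_def by (rule someI[of "\<lambda>y. y \<in> paths G \<and> y t = x"])
qed

end

(* Inclusion: an equilibrium at (t, x) restricts to an equilibrium at every (T0, y), since all y are
   reached with positive probability, and its continuation costs serve as psi; a deviation before T0
   is followed by the original control, which stays state dependent.
   Strictness: psi can choose different continuation equilibria at different states of time T0. After
   the paths from these states merge, no single state dependent profile realises that choice. *)
theory Submission
  imports Defs
begin

section \<open>One-step decomposition of path laws and costs\<close>

lemma set_path_law:
  assumes "is_game G" "\<alpha> \<in> profiles G" "t \<le> horizon G" "x \<in> paths G"
  shows "set_pmf (path_law G t x \<alpha>) \<subseteq> paths_from G t x"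
  by (auto simp: set_pmf_eq pmf_path_law[OF assms] path_density_def split: if_splits)

lemma integrable_path_law:
  fixes c :: "_ \<Rightarrow> real"
  assumes "is_game G" "\<alpha> \<in> profiles G" "t \<le> horizon G" "x \<in> paths G"
  shows "integrable (path_law G t x \<alpha>) c"
proof (rule integrable_measure_pmf_finite, rule finite_subset)
  show "set_pmf (path_law G t x \<alpha>) \<subseteq> paths G"
    using set_path_law[OF assms] by (auto simp: paths_from_def)
qed (rule finite_paths[OF assms(1)])

text \<open>Sorting the paths that continue \<open>x\<close> by their value at time
  \<open>Suc s\<close> splits the finite sum. The first factor of each path density is the
  transition probability to that value, and the remaining product is the density of the law started
  one step later.\<close>

lemma expectation_path_law_first_step:
  assumes g: "is_game G" and a: "\<alpha> \<in> profiles G" and s: "s < horizon G" and x: "x \<in> paths G"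
  shows "measure_pmf.expectation (path_law G s x \<alpha>) c =
    (\<Sum>z\<in>states G (Suc s). transition G s x (joint_action G \<alpha> s x) z *
       measure_pmf.expectation (path_law G (Suc s) (x(Suc s := z)) \<alpha>) c)"
proof -
  let ?u = "\<lambda>z. x(Suc s := z)"
  let ?w = "\<lambda>t y. \<Prod>r\<in>{t..<horizon G}. step_prob G \<alpha> r y"
  have u: "?u z \<in> paths G" if "z \<in> states G (Suc s)" for z
    using paths_upd[OF x _ that] s by simp
  have w: "?w s y = transition G s x (joint_action G \<alpha> s x) z * ?w (Suc s) y"
    if z: "z \<in> states G (Suc s)" and y: "y \<in> paths_from G (Suc s) (?u z)" for y z
  proof -
    have yp: "y \<in> paths G" using y by (simp add: paths_from_def)
    have ag: "agree_upto s y x" and yz: "y (Suc s) = z"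
      using y by (auto simp: paths_from_def agree_upto_def)
    have ja: "joint_action G \<alpha> s y = joint_action G \<alpha> s x"
      using joint_action_agree[OF a _ yp x ag] s by simp
    have "joint_action G \<alpha> s x \<in> joint_controls G"
      using joint_action_in[OF a _ x] s by simp
    then have "step_prob G \<alpha> s y = transition G s x (joint_action G \<alpha> s x) z"
      unfolding step_prob_def ja yz using g s yp x z ag by (simp add: is_game_def)
    then show ?thesis using s by (simp add: prod.atLeast_Suc_lessThan)
  qed
  have "measure_pmf.expectation (path_law G s x \<alpha>) c =
      (\<Sum>y\<in>(\<Union>z\<in>states G (Suc s). paths_from G (Suc s) (?u z)). ?w s y * c y)"
    using expectation_path_law[OF g a _ x] s paths_from_split[OF s x] by simp
  also have "\<dots> = (\<Sum>z\<in>states G (Suc s). \<Sum>y\<in>paths_from G (Suc s) (?u z). ?w s y * c y)"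
  proof (rule sum.UNION_disjoint)
    show "finite (states G (Suc s))" using g s by (simp add: is_game_def)
    show "\<forall>z\<in>states G (Suc s). finite (paths_from G (Suc s) (?u z))"
      using finite_paths[OF g] by (simp add: paths_from_def)
  qed (auto simp: paths_from_def agree_upto_def)
  also have "\<dots> = (\<Sum>z\<in>states G (Suc s). transition G s x (joint_action G \<alpha> s x) z *
       measure_pmf.expectation (path_law G (Suc s) (?u z) \<alpha>) c)"
  proof (rule sum.cong[OF refl])
    fix z assume z: "z \<in> states G (Suc s)"
    show "(\<Sum>y\<in>paths_from G (Suc s) (?u z). ?w s y * c y) =
        transition G s x (joint_action G \<alpha> s x) z *
          measure_pmf.expectation (path_law G (Suc s) (?u z) \<alpha>) c"
      unfolding expectation_path_law[OF g a Suc_leI[OF s] u[OF z]] sum_distrib_left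
      by (intro sum.cong refl) (simp add: w[OF z])
  qed
  finally show ?thesis .
qed

lemma cost_upto_first_step:
  assumes G: "state_dependent_game G" and a: "\<alpha> \<in> state_profiles G" and i: "i \<in> players G"
    and s: "s < T0" "T0 \<le> horizon G" and x: "x \<in> paths G"
  shows "cost_upto G T0 \<psi> s x \<alpha> i = running_cost G i s x (\<alpha> i s x) +
    (\<Sum>z\<in>states G (Suc s). transition G s x (joint_action G \<alpha> s x) z *
       cost_upto G T0 \<psi> (Suc s) (x(Suc s := z)) \<alpha> i)"
proof -
  have g: "is_game G" using G by (simp add: state_dependent_game_def)
  have a': "\<alpha> \<in> profiles G" using a state_profiles_subset by blast
  have sT: "s < horizon G" using s by simp
  let ?f = "\<lambda>r X. running_cost G i r X (\<alpha> i r X)"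
  let ?c = "\<lambda>t X. \<psi> (X T0) i + (\<Sum>r\<in>{t..<T0}. ?f r X)"
  let ?q = "transition G s x (joint_action G \<alpha> s x)"
  \<comment> \<open>Almost every path has the value \<open>x s\<close> at time \<open>s\<close>, so
    by state dependence the running cost of that time is a constant and leaves the
    expectation.\<close>
  have E: "measure_pmf.expectation (path_law G (Suc s) (x(Suc s := z)) \<alpha>) (?c s) =
      ?f s x + measure_pmf.expectation (path_law G (Suc s) (x(Suc s := z)) \<alpha>) (?c (Suc s))"
    (is "measure_pmf.expectation ?P _ = _")
    if z: "z \<in> states G (Suc s)" for z
  proof -
    have u: "x(Suc s := z) \<in> paths G" using paths_upd[OF x _ z] sT by simp
    have "measure_pmf.expectation ?P (?c s) = measure_pmf.expectation ?P (\<lambda>X. ?f s x + ?c (Suc s) X)"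
    proof (rule integral_cong_AE)
      show "AE X in measure_pmf ?P. ?c s X = ?f s x + ?c (Suc s) X"
        unfolding AE_measure_pmf_iff
      proof
        fix X assume "X \<in> set_pmf ?P"
        then have "X \<in> paths G" "X s = x s"
          using set_path_law[OF g a' Suc_leI[OF sT] u] by (auto simp: paths_from_def agree_upto_def)
        then have "?f s X = ?f s x"
          using running_cost_state_eq[OF G a i less_imp_le[OF sT] _ x] by blast
        then show "?c s X = ?f s x + ?c (Suc s) X"
          using s by (simp add: sum.atLeast_Suc_lessThan)
      qed
    qed simp_all
    then show ?thesis
      using integrable_path_law[OF g a' Suc_leI[OF sT] u] by simp
  qed
  have one: "(\<Sum>z\<in>states G (Suc s). ?q z) = 1" using sum_step_prob[OF g a' sT x] .
  have "cost_upto G T0 \<psi> s x \<alpha> i =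
      (\<Sum>z\<in>states G (Suc s). ?q z * (?f s x +
        measure_pmf.expectation (path_law G (Suc s) (x(Suc s := z)) \<alpha>) (?c (Suc s))))"
    using i E by (simp add: cost_upto_def expectation_path_law_first_step[OF g a' sT x])
  also have "\<dots> = ?f s x + (\<Sum>z\<in>states G (Suc s). ?q z *
      measure_pmf.expectation (path_law G (Suc s) (x(Suc s := z)) \<alpha>) (?c (Suc s)))"
    using one by (simp add: distrib_left sum.distrib flip: sum_distrib_right)
  finally show ?thesis using i by (simp add: cost_upto_def)
qed

section \<open>Deviations and pasting of controls\<close>

lemma state_profiles_upd:
  "\<alpha> \<in> state_profiles G \<Longrightarrow> \<beta> \<in> state_controls G i \<Longrightarrow> \<alpha>(i := \<beta>) \<in> state_profiles G"
  by (auto simp: state_profiles_def)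

lemma state_profiles_apply:
  "\<alpha> \<in> state_profiles G \<Longrightarrow> i \<in> players G \<Longrightarrow> \<alpha> i \<in> state_controls G i"
  by (auto simp: state_profiles_def)

text \<open>The switching condition sees only the time and the current state, so the result still
  forgets the past. It is applied to deviations at a single state and to deviations stopped at
  \<open>T0\<close>.\<close>

lemma state_controls_paste:
  assumes "\<beta> \<in> state_controls G i" "\<gamma> \<in> state_controls G i"
  shows "(\<lambda>s X. if P s (X s) then \<beta> s X else \<gamma> s X) \<in> state_controls G i"
proof -
  let ?\<delta> = "\<lambda>s X. if P s (X s) then \<beta> s X else \<gamma> s X"
  have "?\<delta> s X \<in> controls G i" if "s \<le> horizon G" "X \<in> paths G" for s X
    using assms that by (simp add: state_controls_def adapted_controls_def)
  moreover have "adapted G ?\<delta>"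
    unfolding adapted_def
  proof (intro allI impI ballI)
    fix s X Y assume "s \<le> horizon G" "X \<in> paths G" "Y \<in> paths G" "agree_upto s X Y"
    then have "\<beta> s X = \<beta> s Y" "\<gamma> s X = \<gamma> s Y" "X s = Y s"
      using assms unfolding state_controls_def adapted_controls_def adapted_def agree_upto_def by blast+
    then show "?\<delta> s X = ?\<delta> s Y" by simp
  qed
  moreover have "state_dependent G ?\<delta>"
    unfolding state_dependent_def
  proof (intro allI impI ballI)
    fix s X Y assume "s \<le> horizon G" "X \<in> paths G" "Y \<in> paths G" and e: "X s = Y s"
    then have "\<beta> s X = \<beta> s Y" "\<gamma> s X = \<gamma> s Y"
      using assms unfolding state_controls_def state_dependent_def by blast+
    then show "?\<delta> s X = ?\<delta> s Y" using e by simp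
  qed
  ultimately show ?thesis by (simp add: state_controls_def adapted_controls_def)
qed

lemma state_cost_upto_extensional: "state_cost_upto G T0 \<psi> t x \<alpha> \<in> extensional (players G)"
  by (simp add: state_cost_upto_def cost_upto_def)

section \<open>Backward recursion over states and persistence of equilibria\<close>

context
  fixes G :: "('s, 'a) game"
  assumes G: "state_dependent_game G"
begin

lemma is_game: "is_game G"
  using G by (simp add: state_dependent_game_def)

lemma state_transition_pos:
  assumes "\<alpha> \<in> state_profiles G" "s < horizon G" "x \<in> states G s" "z \<in> states G (Suc s)"
  shows "0 < transition G s (path_through G s x) (joint_action G \<alpha> s (path_through G s x)) z"
  using assms is_game path_through[OF is_game, of s x] state_profiles_subset[of G]
    joint_action_in[of \<alpha> G s "path_through G s x"]
  by (auto simp: is_game_def subset_iff)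

lemma state_cost_upto_end:
  assumes "\<alpha> \<in> state_profiles G" "T0 \<le> horizon G" "x \<in> states G T0" "i \<in> players G"
  shows "state_cost_upto G T0 \<psi> T0 x \<alpha> i = \<psi> x i"
proof -
  let ?p = "path_through G T0 x"
  have p: "?p \<in> paths G" "?p T0 = x" using path_through[OF is_game assms(2,3)] by auto
  have a: "\<alpha> \<in> profiles G" using assms(1) state_profiles_subset by blast
  have "measure_pmf.expectation (path_law G T0 ?p \<alpha>) (\<lambda>X. \<psi> (X T0) i) =
      measure_pmf.expectation (path_law G T0 ?p \<alpha>) (\<lambda>X. \<psi> x i)"
  proof (rule integral_cong_AE)
    show "AE X in measure_pmf (path_law G T0 ?p \<alpha>). \<psi> (X T0) i = \<psi> x i"
      using set_path_law[OF is_game a assms(2) p(1)] p(2)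
      by (auto simp: AE_measure_pmf_iff paths_from_def agree_upto_def)
  qed simp_all
  then show ?thesis using assms(4) by (simp add: state_cost_upto_def cost_upto_def)
qed

text \<open>The updated path need not be the one that \<open>path_through\<close> picks for
  \<open>z\<close>, but both pass through \<open>z\<close>, which determines the cost of a state
  dependent profile. This gives a recursion over states alone, starting from
  \<open>state_cost_upto_end\<close>.\<close>

lemma state_cost_upto_first_step:
  assumes a: "\<alpha> \<in> state_profiles G" and i: "i \<in> players G"
    and s: "s < T0" "T0 \<le> horizon G" and x: "x \<in> states G s"
  shows "state_cost_upto G T0 \<psi> s x \<alpha> i =
    running_cost G i s (path_through G s x) (\<alpha> i s (path_through G s x)) +
    (\<Sum>z\<in>states G (Suc s).
       transition G s (path_through G s x) (joint_action G \<alpha> s (path_through G s x)) z *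
       state_cost_upto G T0 \<psi> (Suc s) z \<alpha> i)"
proof -
  let ?p = "path_through G s x"
  have p: "?p \<in> paths G" using path_through[OF is_game _ x] s by simp
  have "cost_upto G T0 \<psi> (Suc s) (?p(Suc s := z)) \<alpha> = state_cost_upto G T0 \<psi> (Suc s) z \<alpha>"
    if z: "z \<in> states G (Suc s)" for z
    unfolding state_cost_upto_def
    using s path_through[OF is_game _ z] paths_upd[OF p _ z]
    by (intro cost_upto_state_eq[OF G a]) auto
  then show ?thesis
    unfolding state_cost_upto_def[of G T0 \<psi> s x] cost_upto_first_step[OF G a i s p] by simp
qed

text \<open>Puts the terminal cost into the form of a \<psi>, so that one recursion serves full and
  truncated costs. For a player \<open>i\<close>, every path ending in \<open>y\<close> would give
  the same value.\<close>

definition terminal_value :: "'s \<Rightarrow> nat \<Rightarrow> real" where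
  "terminal_value y i = terminal_cost G i (path_through G (horizon G) y)"

lemma state_cost_eq_upto:
  assumes a: "\<alpha> \<in> state_profiles G" and t: "t \<le> horizon G" and x: "x \<in> states G t"
  shows "state_cost G t x \<alpha> = state_cost_upto G (horizon G) terminal_value t x \<alpha>"
  unfolding state_cost_def state_cost_upto_def cost_def cost_upto_def
proof (rule restrict_ext)
  fix i assume i: "i \<in> players G"
  let ?P = "path_law G t (path_through G t x) \<alpha>"
  have "\<alpha> \<in> profiles G" using a state_profiles_subset by blast
  then have sub: "set_pmf ?P \<subseteq> paths G"
    using set_path_law[OF is_game _ t] path_through[OF is_game t x] by (auto simp: paths_from_def)
  have "terminal_cost G i X = terminal_value (X (horizon G)) i" if X: "X \<in> paths G" for X
    unfolding terminal_value_def
    using G i X path_through[OF is_game order_refl paths_memD[OF X order_refl]]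
    unfolding state_dependent_game_def by metis
  with sub show "measure_pmf.expectation ?P
      (\<lambda>X. terminal_cost G i X + (\<Sum>s\<in>{t..<horizon G}. running_cost G i s X (\<alpha> i s X))) =
    measure_pmf.expectation ?P
      (\<lambda>X. terminal_value (X (horizon G)) i + (\<Sum>s\<in>{t..<horizon G}. running_cost G i s X (\<alpha> i s X)))"
    by (intro integral_cong_AE) (auto simp: AE_measure_pmf_iff)
qed

lemma state_equilibrium_le:
  assumes "state_equilibrium G t x \<alpha>" "t \<le> horizon G" "x \<in> states G t"
    and "i \<in> players G" "\<beta> \<in> state_controls G i"
  shows "state_cost_upto G (horizon G) terminal_value t x \<alpha> i \<le>
    state_cost_upto G (horizon G) terminal_value t x (\<alpha>(i := \<beta>)) i"
proof -
  have a: "\<alpha> \<in> state_profiles G" using assms(1) by (simp add: state_equilibrium_def)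
  have "state_cost G t x \<alpha> i \<le> state_cost G t x (\<alpha>(i := \<beta>)) i"
    using assms(1,4,5) unfolding state_equilibrium_def by blast
  then show ?thesis
    unfolding state_cost_eq_upto[OF a assms(2,3)]
      state_cost_eq_upto[OF state_profiles_upd[OF a assms(5)] assms(2,3)] .
qed

text \<open>In the recursion only actions from \<open>t\<close> until just before \<open>T0\<close>
  enter. Pasted deviations can thus be exchanged for the profile they coincide with on a given range
  of times.\<close>

lemma state_cost_upto_cong:
  assumes a: "\<alpha> \<in> state_profiles G" "\<alpha>' \<in> state_profiles G" and i: "i \<in> players G"
    and "t \<le> T0" and T0: "T0 \<le> horizon G" and "x \<in> states G t"
    and eq: "\<And>j s X. j \<in> players G \<Longrightarrow> t \<le> s \<Longrightarrow> s < T0 \<Longrightarrow> \<alpha> j s X = \<alpha>' j s X"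
    and \<psi>: "\<And>y. y \<in> states G T0 \<Longrightarrow> \<psi> y i = \<psi>' y i"
  shows "state_cost_upto G T0 \<psi> t x \<alpha> i = state_cost_upto G T0 \<psi>' t x \<alpha>' i"
  using assms(4,6) eq
proof (induction t arbitrary: x rule: inc_induct)
  case base
  then show ?case using a i T0 \<psi> by (simp add: state_cost_upto_end)
next
  case (step s)
  have "joint_action G \<alpha> s = joint_action G \<alpha>' s"
    using step.prems(2) step.hyps by (intro ext) (simp add: joint_action_def)
  moreover have "state_cost_upto G T0 \<psi> (Suc s) z \<alpha> i = state_cost_upto G T0 \<psi>' (Suc s) z \<alpha>' i"
    if "z \<in> states G (Suc s)" for z
    using step.IH[OF that] step.prems(2) by simp
  ultimately show ?case
    using step.prems step.hyps a i T0 by (simp add: state_cost_upto_first_step)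
qed

text \<open>Dynamic programming for a fixed profile: both sides obey the same recursion before
  \<open>T0\<close> and agree at \<open>T0\<close>.\<close>

lemma state_cost_upto_tower:
  assumes a: "\<alpha> \<in> state_profiles G" and i: "i \<in> players G"
    and "t \<le> T0" and T: "T0 \<le> T1" "T1 \<le> horizon G" and "x \<in> states G t"
  shows "state_cost_upto G T0 (\<lambda>y. state_cost_upto G T1 \<psi> T0 y \<alpha>) t x \<alpha> i =
    state_cost_upto G T1 \<psi> t x \<alpha> i"
  using assms(3,6)
proof (induction t arbitrary: x rule: inc_induct)
  case base
  then show ?case using a i T by (simp add: state_cost_upto_end)
next
  case (step s)
  then show ?case using a i T by (simp add: state_cost_upto_first_step)
qed

text \<open>One step before \<open>T0\<close>, the positive transition to \<open>y\<close> makes the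
  inequality strict at every state. At earlier times all successors are already strict, and positive
  weights preserve this.\<close>

lemma state_cost_upto_strict_mono:
  assumes a: "\<alpha> \<in> state_profiles G" and i: "i \<in> players G"
    and "t < T0" and T0: "T0 \<le> horizon G" and "x \<in> states G t"
    and \<psi>: "\<And>y. y \<in> states G T0 \<Longrightarrow> \<psi> y i \<le> \<psi>' y i"
    and y: "y \<in> states G T0" "\<psi> y i < \<psi>' y i"
  shows "state_cost_upto G T0 \<psi> t x \<alpha> i < state_cost_upto G T0 \<psi>' t x \<alpha> i"
  using assms(3,5)
proof (induction t arbitrary: x rule: strict_inc_induct)
  case (base s)
  then show ?case
    using a i T0 \<psi> y state_transition_pos[OF a, of s x] is_game
    by (auto simp: state_cost_upto_first_step state_cost_upto_end is_game_def less_imp_le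
        intro!: sum_strict_mono_ex1 mult_left_mono mult_strict_left_mono bexI[of _ y])
next
  case (step s)
  have s: "s < horizon G" using step.hyps T0 by simp
  have "finite (states G (Suc s))" "states G (Suc s) \<noteq> {}"
    using is_game s by (auto simp: is_game_def)
  then show ?case
    using step a i T0 s state_transition_pos[OF a s step.prems]
    by (auto simp: state_cost_upto_first_step intro!: sum_strict_mono mult_strict_left_mono)
qed

text \<open>Every state at a later time is reached with positive probability, so a profitable deviation
  at a single \<open>(s, y)\<close> would be profitable from \<open>(t, x)\<close>. Deviating at one state only is essential:
  a better control for the subgame at \<open>y\<close> may do worse from the other states at time \<open>s\<close>.\<close>

lemma state_equilibrium_later:
  assumes eq: "state_equilibrium G t x \<alpha>" and x: "x \<in> states G t"
    and s: "t < s" "s \<le> horizon G" and y: "y \<in> states G s"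
  shows "state_equilibrium G s y \<alpha>"
proof -
  have a: "\<alpha> \<in> state_profiles G" using eq by (simp add: state_equilibrium_def)
  let ?J = "state_cost_upto G (horizon G) terminal_value"
  \<comment> \<open>One-shot deviation principle: backward induction on \<open>s\<close> makes
    \<alpha> optimal against deviations from \<open>Suc s\<close> on, so only the action at
    \<open>(s, y)\<close> remains to be examined.\<close>
  have "?J s y \<alpha> i \<le> ?J s y (\<alpha>(i := \<beta>)) i"
    if i: "i \<in> players G" and \<beta>: "\<beta> \<in> state_controls G i" for i \<beta>
    using s(2,1) y
  proof (induction s arbitrary: y rule: inc_induct)
    case base
    then show ?case
      by (simp add: state_cost_upto_end[OF a] state_cost_upto_end[OF state_profiles_upd[OF a \<beta>]] i
          del: fun_upd_apply)
  next
    case (step s)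
    note b = state_profiles_upd[OF a \<beta>]
    have sT: "s < horizon G" and ts: "t < s" and y: "y \<in> states G s"
      using step.hyps step.prems by auto
    show ?case
    proof (rule ccontr)
      assume "\<not> ?thesis"
      then have less: "?J s y (\<alpha>(i := \<beta>)) i < ?J s y \<alpha> i" by (rule not_le_imp_less)
      define \<gamma> where "\<gamma> = (\<lambda>r X. if r = s \<and> X r = y then \<beta> r X else \<alpha> i r X)"
      have \<gamma>: "\<gamma> \<in> state_controls G i"
        unfolding \<gamma>_def
        by (rule state_controls_paste[OF \<beta> state_profiles_apply[OF a i], of "\<lambda>r w. r = s \<and> w = y"])
      note c = state_profiles_upd[OF a \<gamma>]
      have later: "?J (Suc s) z (\<alpha>(i := \<gamma>)) i = ?J (Suc s) z \<alpha> i" if "z \<in> states G (Suc s)" for z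
        using sT that by (intro state_cost_upto_cong[OF c a i]) (auto simp: \<gamma>_def)
      have p: "path_through G s w s = w" if "w \<in> states G s" for w
        using path_through[OF is_game _ that] sT by simp
      have other: "?J s w (\<alpha>(i := \<gamma>)) i = ?J s w \<alpha> i"
        if w: "w \<in> states G s" "w \<noteq> y" for w
      proof -
        let ?p = "path_through G s w"
        have act: "(\<alpha>(i := \<gamma>)) i s ?p = \<alpha> i s ?p" using p[OF w(1)] w(2) by (simp add: \<gamma>_def)
        have ja: "joint_action G (\<alpha>(i := \<gamma>)) s ?p = joint_action G \<alpha> s ?p"
          unfolding joint_action_def by (rule restrict_ext) (use act in auto)
        show ?thesis
          unfolding state_cost_upto_first_step[OF c i sT order_refl w(1)]
            state_cost_upto_first_step[OF a i sT order_refl w(1)] act ja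
          by (simp only: later cong: sum.cong)
      qed
      \<comment> \<open>At \<open>y\<close> the control \<gamma> takes the action of \<beta> and
        then returns to \<alpha>. By the induction hypothesis that continuation costs no more than
        the one of \<beta>, so \<gamma> inherits the strict gain.\<close>
      have "?J s y (\<alpha>(i := \<gamma>)) i \<le> ?J s y (\<alpha>(i := \<beta>)) i"
      proof -
        let ?p = "path_through G s y"
        have act: "(\<alpha>(i := \<gamma>)) i s ?p = (\<alpha>(i := \<beta>)) i s ?p" using p[OF y] by (simp add: \<gamma>_def)
        have ja: "joint_action G (\<alpha>(i := \<gamma>)) s ?p = joint_action G (\<alpha>(i := \<beta>)) s ?p"
          unfolding joint_action_def by (rule restrict_ext) (use act in auto)
        show ?thesis
          unfolding state_cost_upto_first_step[OF c i sT order_refl y]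
            state_cost_upto_first_step[OF b i sT order_refl y] act ja
        proof (intro add_left_mono sum_mono mult_left_mono)
          fix z assume z: "z \<in> states G (Suc s)"
          show "?J (Suc s) z (\<alpha>(i := \<gamma>)) i \<le> ?J (Suc s) z (\<alpha>(i := \<beta>)) i"
            unfolding later[OF z] by (rule step.IH[OF less_SucI[OF ts] z])
          show "0 \<le> transition G s ?p (joint_action G (\<alpha>(i := \<beta>)) s ?p) z"
            by (rule less_imp_le[OF state_transition_pos[OF b sT y z]])
        qed
      qed
      then have strict: "?J s y (\<alpha>(i := \<gamma>)) i < ?J s y \<alpha> i" using less by (rule le_less_trans)
      \<comment> \<open>Before \<open>s\<close> the two profiles coincide, so the tower identity
        reduces the comparison at \<open>(t, x)\<close> to the values at time \<open>s\<close>: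
        strictly smaller at \<open>y\<close>, equal elsewhere.\<close>
      have "?J t x (\<alpha>(i := \<gamma>)) i =
          state_cost_upto G s (\<lambda>w. ?J s w (\<alpha>(i := \<gamma>))) t x (\<alpha>(i := \<gamma>)) i"
        using sT ts x by (intro state_cost_upto_tower[OF c i, symmetric]) auto
      also have "\<dots> = state_cost_upto G s (\<lambda>w. ?J s w (\<alpha>(i := \<gamma>))) t x \<alpha> i"
        using sT ts x by (intro state_cost_upto_cong[OF c a i]) (auto simp: \<gamma>_def)
      also have "\<dots> < state_cost_upto G s (\<lambda>w. ?J s w \<alpha>) t x \<alpha> i"
      proof (rule state_cost_upto_strict_mono[OF a i ts less_imp_le[OF sT] x])
        show "?J s w (\<alpha>(i := \<gamma>)) i \<le> ?J s w \<alpha> i" if "w \<in> states G s" for w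
          using other[OF that] less_imp_le[OF strict] by (cases "w = y") simp_all
      qed (rule y strict)+
      also have "\<dots> = ?J t x \<alpha> i"
        using sT ts x by (intro state_cost_upto_tower[OF a i]) auto
      finally have "?J t x (\<alpha>(i := \<gamma>)) i < ?J t x \<alpha> i" .
      moreover have "?J t x \<alpha> i \<le> ?J t x (\<alpha>(i := \<gamma>)) i"
        using sT ts by (intro state_equilibrium_le[OF eq _ x i \<gamma>]) simp
      ultimately show False by linarith
    qed
  qed
  then show ?thesis
    using a s y
    by (simp add: state_equilibrium_def state_cost_eq_upto state_profiles_upd del: fun_upd_apply)
qed

section \<open>Inclusion of the set values\<close>

lemma V_state_subset:
  assumes t: "t < T0" "T0 \<le> horizon G" and x: "x \<in> states G t"
  shows "V_state G t x \<subseteq> V_state_tilde G T0 t x"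
proof
  fix v assume "v \<in> V_state G t x"
  then obtain \<alpha> where v: "v = state_cost G t x \<alpha>" and eq: "state_equilibrium G t x \<alpha>"
    by (auto simp: V_state_def)
  have a: "\<alpha> \<in> state_profiles G" using eq by (simp add: state_equilibrium_def)
  let ?J = "state_cost_upto G (horizon G) terminal_value"
  let ?\<psi> = "\<lambda>y. ?J T0 y \<alpha>"
  have tower: "state_cost_upto G T0 ?\<psi> t x \<alpha> i = ?J t x \<alpha> i" if "i \<in> players G" for i
    using t x by (intro state_cost_upto_tower[OF a that]) auto
  have "v = state_cost_upto G T0 ?\<psi> t x \<alpha>"
    unfolding v
  proof (rule extensionalityI[where A = "players G"])
    show "state_cost G t x \<alpha> \<in> extensional (players G)" by (simp add: state_cost_def cost_def)
    show "state_cost G t x \<alpha> i = state_cost_upto G T0 ?\<psi> t x \<alpha> i" if "i \<in> players G" for i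
      using tower[OF that] state_cost_eq_upto[OF a _ x] t by simp
  qed (rule state_cost_upto_extensional)
  moreover have "\<forall>y\<in>states G T0. ?\<psi> y \<in> V_state G T0 y"
  proof
    fix y assume y: "y \<in> states G T0"
    show "?\<psi> y \<in> V_state G T0 y"
      using state_equilibrium_later[OF eq x t y] state_cost_eq_upto[OF a t(2) y]
      unfolding V_state_def by (metis (mono_tags, lifting) mem_Collect_eq)
  qed
  moreover have "state_equilibrium_upto G T0 ?\<psi> t x \<alpha>"
    unfolding state_equilibrium_upto_def
  proof (intro conjI ballI a)
    fix i \<beta> assume i: "i \<in> players G" and \<beta>: "\<beta> \<in> state_controls G i"
    define \<gamma> where "\<gamma> = (\<lambda>r X. if r < T0 then \<beta> r X else \<alpha> i r X)"
    have \<gamma>: "\<gamma> \<in> state_controls G i"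
      unfolding \<gamma>_def
      by (rule state_controls_paste[OF \<beta> state_profiles_apply[OF a i], of "\<lambda>r w. r < T0"])
    note b = state_profiles_upd[OF a \<beta>] and c = state_profiles_upd[OF a \<gamma>]
    have "state_cost_upto G T0 ?\<psi> t x \<alpha> i = ?J t x \<alpha> i" by (rule tower[OF i])
    also have "\<dots> \<le> ?J t x (\<alpha>(i := \<gamma>)) i"
      using t by (intro state_equilibrium_le[OF eq _ x i \<gamma>]) simp
    also have "\<dots> = state_cost_upto G T0 (\<lambda>y. ?J T0 y (\<alpha>(i := \<gamma>))) t x (\<alpha>(i := \<gamma>)) i"
      using t x by (intro state_cost_upto_tower[OF c i, symmetric]) auto
    \<comment> \<open>From \<open>T0\<close> on \<gamma> follows \<alpha>, whose continuation costs
      are \<open>?\<psi>\<close>; before \<open>T0\<close> it follows \<beta>. The full cost of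
      \<gamma> is therefore the truncated cost of \<beta>.\<close>
    also have "\<dots> = state_cost_upto G T0 ?\<psi> t x (\<alpha>(i := \<beta>)) i"
    proof (rule state_cost_upto_cong[OF c b i])
      show "?J T0 y (\<alpha>(i := \<gamma>)) i = ?J T0 y \<alpha> i" if "y \<in> states G T0" for y
        using t that by (intro state_cost_upto_cong[OF c a i]) (auto simp: \<gamma>_def)
    qed (use t x in \<open>auto simp: \<gamma>_def\<close>)
    finally show "state_cost_upto G T0 ?\<psi> t x \<alpha> i \<le> state_cost_upto G T0 ?\<psi> t x (\<alpha>(i := \<beta>)) i" .
  qed
  ultimately show "v \<in> V_state_tilde G T0 t x" by (auto simp: V_state_tilde_def)
qed

end

section \<open>A coordination game with strict inclusion\<close>

text \<open>A mismatch costs more than either match, so both matches are stable, and the two matches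
  differ in value. All values lie strictly between 0 and 1, which keeps the transitions
  positive.\<close>

definition coordination_prob :: "(nat \<Rightarrow> real) \<Rightarrow> real" where
  "coordination_prob a = (if a 1 \<noteq> a 2 then 3/4 else if a 1 = 0 then 1/4 else 1/2)"

text \<open>Matching on \<open>0\<close> and matching on \<open>1\<close> are equilibria of different value at time \<open>2\<close>. An auxiliary
  \<open>\<psi>\<close> at time \<open>1\<close> may select one of them after state \<open>0\<close> and the other after state \<open>1\<close>, but a state
  dependent profile forgets that state when the paths merge at time \<open>2\<close>.\<close>

definition coordination_game :: "(nat, real) game" where
  "coordination_game = \<lparr>horizon = 3, states = (\<lambda>t. {0, t mod 2}), n_players = 2,
     control_space = (\<lambda>i. discrete_topology {0, 1}), controls = (\<lambda>i. {0, 1}),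
     transition = (\<lambda>t x a z.
       if t = 0 then 1/2 else if t = 1 then 1
       else if z = 1 then coordination_prob a else 1 - coordination_prob a),
     running_cost = (\<lambda>i t x a. 0), terminal_cost = (\<lambda>i x. real (x 3))\<rparr>"

lemma coordination_game_simps [simp]:
  "horizon coordination_game = 3"
  "states coordination_game t = {0, t mod 2}"
  "players coordination_game = {1, 2}"
  "controls coordination_game i = {0, 1}"
  "running_cost coordination_game i t x b = 0"
  "terminal_cost coordination_game i x = real (x 3)"
  "transition coordination_game t x a z =
     (if t = 0 then 1/2 else if t = 1 then 1
      else if z = 1 then coordination_prob a else 1 - coordination_prob a)"
  by (auto simp: coordination_game_def players_def)

lemma state_dependent_coordination_game: "state_dependent_game coordination_game"
proof -
  have t: "t = 0 \<or> t = 1 \<or> t = 2" if "t < 3" for t :: nat using that by auto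
  have c: "control_space coordination_game i = discrete_topology {0, 1}" "0 < n_players coordination_game" for i
    by (simp_all add: coordination_game_def)
  have "{0, 1} \<in> sets (borel_of_topology (discrete_topology {0, 1::real}))"
    using sets.top[of "borel_of_topology (discrete_topology {0, 1::real})"]
    by (simp add: borel_of_topology_def)
  moreover have "running_cost coordination_game i t x = (\<lambda>b. 0)" for i t x
    by (simp add: fun_eq_iff)
  ultimately show ?thesis
    unfolding state_dependent_game_def is_game_def
    by (auto simp: c adapted_def state_dependent_def coordination_prob_def dest!: t)
qed

text \<open>Actions influence the law only at time 2, where 0 is the single state, and the cost is
  the final state. Full costs thus equal the probability of ending in 1, for both players and from
  every earlier state. The cost truncated at time 1 is the plain mean of \<psi>, whatever the
  profile.\<close>

lemma coordination_game_costs: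
  assumes "\<alpha> \<in> state_profiles coordination_game" "i \<in> {1, 2}"
  defines "v \<equiv> coordination_prob
    (joint_action coordination_game \<alpha> 2 (path_through coordination_game 2 0))"
  shows "y \<in> {0, 1} \<Longrightarrow> state_cost coordination_game 1 y \<alpha> i = v"
    and "state_cost coordination_game 0 0 \<alpha> i = v"
    and "state_cost_upto coordination_game 1 \<psi> 0 0 \<alpha> i = (\<psi> 0 i + \<psi> 1 i) / 2"
proof -
  note G = state_dependent_coordination_game
  let ?J = "state_cost_upto coordination_game 3 (terminal_value coordination_game)"
  have i: "i \<in> players coordination_game" using assms(2) by simp
  note first = state_cost_upto_first_step[OF G assms(1) i] and last = state_cost_upto_end[OF G assms(1) _ _ i]
  have J3: "?J 3 z \<alpha> i = real z" if "z \<in> {0, 1}" for z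
    using that last[of 3 z] path_through[OF is_game[OF G], of 3 z]
    by (auto simp: terminal_value_def[OF G])
  have "?J 2 0 \<alpha> i = (\<Sum>z\<in>{0, 1}. (if z = 1 then v else 1 - v) * ?J 3 z \<alpha> i)"
    using first[of 2 3 0] by (simp add: v_def)
  then have J2: "?J 2 0 \<alpha> i = v" by (simp add: J3)
  have J1: "?J 1 z \<alpha> i = v" if "z \<in> {0, 1}" for z
    using first[of 1 3 z] that J2 unfolding Suc_1 by simp
  show "y \<in> {0, 1} \<Longrightarrow> state_cost coordination_game 1 y \<alpha> i = v"
    using J1 state_cost_eq_upto[OF G assms(1), of 1 y] by simp
  have "?J 0 0 \<alpha> i = (\<Sum>z\<in>{0, 1}. 1/2 * ?J 1 z \<alpha> i)"
    using first[of 0 3 0] by simp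
  then have "?J 0 0 \<alpha> i = v" by (simp only: J1 cong: sum.cong) simp
  then show "state_cost coordination_game 0 0 \<alpha> i = v"
    using state_cost_eq_upto[OF G assms(1), of 0 0] by simp
  show "state_cost_upto coordination_game 1 \<psi> 0 0 \<alpha> i = (\<psi> 0 i + \<psi> 1 i) / 2"
    using first[of 0 1 0] last[of 1] by (simp add: add_divide_distrib)
qed

lemma const_state_control:
  "b \<in> controls G i \<Longrightarrow> (\<lambda>t x. b) \<in> state_controls G i"
  by (simp add: state_controls_def adapted_controls_def state_dependent_def adapted_def)

text \<open>Both players constantly choose \<open>b\<close>. A unilateral deviation either keeps the
  match at time 2 or produces a mismatch of cost 3/4, exceeding both match values.\<close>

lemma coordination_game_V_state:
  fixes b :: real
  assumes y: "y \<in> {0, 1}" and b: "b \<in> {0, 1}"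
  shows "(\<lambda>i\<in>{1, 2}. if b = 0 then 1/4 else 1/2) \<in> V_state coordination_game 1 y"
proof -
  let ?\<alpha> = "(\<lambda>i t x. b) :: (nat, real) profile"
  have a: "?\<alpha> \<in> state_profiles coordination_game"
    using b by (simp add: state_profiles_def const_state_control)
  have cost: "state_cost coordination_game 1 y ?\<alpha> i = (if b = 0 then 1/4 else 1/2)" if "i \<in> {1, 2}" for i
    unfolding coordination_game_costs(1)[OF a that y] by (simp add: coordination_prob_def joint_action_def)
  have "state_cost coordination_game 1 y ?\<alpha> i \<le> state_cost coordination_game 1 y (?\<alpha>(i := \<beta>)) i"
    if i: "i \<in> {1, 2}" and \<beta>: "\<beta> \<in> state_controls coordination_game i" for i \<beta>
  proof -
    have "path_through coordination_game 2 0 \<in> paths coordination_game"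
      using path_through[OF is_game[OF state_dependent_coordination_game], of 2 0] by simp
    then have "\<beta> 2 (path_through coordination_game 2 0) \<in> {0, 1}"
      using \<beta> by (simp add: state_controls_def adapted_controls_def)
    then show ?thesis
      unfolding coordination_game_costs(1)[OF a i y]
        coordination_game_costs(1)[OF state_profiles_upd[OF a \<beta>] i y]
      using i b by (auto simp: coordination_prob_def joint_action_def)
  qed
  then have "state_equilibrium coordination_game 1 y ?\<alpha>"
    using a by (simp add: state_equilibrium_def)
  moreover have "(\<lambda>i\<in>{1, 2}. if b = 0 then 1/4 else 1/2) = state_cost coordination_game 1 y ?\<alpha>"
  proof (rule extensionalityI[where A = "{1, 2}"])
    show "state_cost coordination_game 1 y ?\<alpha> \<in> extensional {1, 2}"
      by (simp add: state_cost_def cost_def del: One_nat_def)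
  qed (simp_all only: cost restrict_apply if_True restrict_extensional)
  ultimately show ?thesis unfolding V_state_def by blast
qed

lemma coordination_game_V_state_neq:
  "V_state coordination_game 0 0 \<noteq> V_state_tilde coordination_game 1 0 0"
proof
  assume eq: "V_state coordination_game 0 0 = V_state_tilde coordination_game 1 0 0"
  \<comment> \<open>The state at time 1 doubles as the action to match on: state 0 receives the
    value of matching on 0, state 1 that of matching on 1.\<close>
  let ?\<psi> = "\<lambda>y::nat. \<lambda>i\<in>{1, 2::nat}. if real y = 0 then 1/4 else 1/2 :: real"
  \<comment> \<open>The truncated cost is the same for all profiles, so every state dependent
    profile is an equilibrium for \<open>?\<psi>\<close>; the constant 0 is one choice.\<close>
  let ?\<alpha> = "(\<lambda>i t x. 0) :: (nat, real) profile"
  have a: "?\<alpha> \<in> state_profiles coordination_game"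
    by (simp add: state_profiles_def const_state_control)
  have "\<forall>y\<in>states coordination_game 1. ?\<psi> y \<in> V_state coordination_game 1 y"
    using coordination_game_V_state[of _ "real _"] by simp
  moreover have "state_equilibrium_upto coordination_game 1 ?\<psi> 0 0 ?\<alpha>"
    unfolding state_equilibrium_upto_def
  proof (intro conjI ballI a)
    fix i \<beta>
    assume i: "i \<in> players coordination_game" and \<beta>: "\<beta> \<in> state_controls coordination_game i"
    have i': "i \<in> {1, 2}" using i by simp
    show "state_cost_upto coordination_game 1 ?\<psi> 0 0 ?\<alpha> i \<le>
        state_cost_upto coordination_game 1 ?\<psi> 0 0 (?\<alpha>(i := \<beta>)) i"
      unfolding coordination_game_costs(3)[OF a i']
        coordination_game_costs(3)[OF state_profiles_upd[OF a \<beta>] i'] by (rule order_refl)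
  qed
  ultimately have "state_cost_upto coordination_game 1 ?\<psi> 0 0 ?\<alpha> \<in> V_state coordination_game 0 0"
    unfolding eq V_state_tilde_def by blast
  then obtain \<alpha> where \<alpha>: "\<alpha> \<in> state_profiles coordination_game"
    and "state_cost_upto coordination_game 1 ?\<psi> 0 0 ?\<alpha> = state_cost coordination_game 0 0 \<alpha>"
    by (auto simp: V_state_def state_equilibrium_def)
  \<comment> \<open>The mean of 1/4 and 1/2 is not a value of \<open>coordination_prob\<close>, so
    no state dependent profile attains it, equilibrium or not.\<close>
  from this(2) have "3/8 = state_cost coordination_game 0 0 \<alpha> 1"
    using coordination_game_costs(3)[OF a, of 1 ?\<psi>] by simp
  then show False
    using coordination_game_costs(2)[OF \<alpha>, of 1] by (simp add: coordination_prob_def split: if_splits)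
qed

theorem proposition2p17:
  shows "(\<forall>(G :: ('s, 'a) game) t T0 x.
            state_dependent_game G \<and> t < T0 \<and> T0 \<le> horizon G \<and> x \<in> states G t \<longrightarrow>
              V_state G t x \<subseteq> V_state_tilde G T0 t x) \<and>
         (\<exists>(G :: (nat, real) game) t T0 x.
            state_dependent_game G \<and> t < T0 \<and> T0 \<le> horizon G \<and> x \<in> states G t \<and>
              V_state G t x \<noteq> V_state_tilde G T0 t x)"
proof (intro conjI allI impI)
  show "V_state G t x \<subseteq> V_state_tilde G T0 t x"
    if "state_dependent_game G \<and> t < T0 \<and> T0 \<le> horizon G \<and> x \<in> states G t"
    for G :: "('s, 'a) game" and t T0 x
    using that by (elim conjE) (rule V_state_subset)
  have "0 < (1::nat)" "1 \<le> horizon coordination_game" "0 \<in> states coordination_game 0"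
    by simp_all
  then show "\<exists>(G :: (nat, real) game) t T0 x.
      state_dependent_game G \<and> t < T0 \<and> T0 \<le> horizon G \<and> x \<in> states G t \<and>
        V_state G t x \<noteq> V_state_tilde G T0 t x"
    using state_dependent_coordination_game coordination_game_V_state_neq by blast
qed

end
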